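(* There is an absolute constant $C>0$ such that for every integer $n\ge5$ there is a unitary signing $\sigma$ of the complete graph $K_n$ for which $K_n^\sigma$ has probabilistic (Las Vegas) uniform mixing in expected time $O(n^{3/2})$: for every start vertex $u$ there is a measured-walk protocol on $K_n^\sigma$, with generator $H=\frac1nA(K_n^\sigma)$, which starts in the state $e_u$, stops with probability $1$, always stops in a uniform state, and whose expected total evolution time is at most $C\,n^{3/2}$.
   Context: A unitary signing $\sigma$ of a graph $X$ assigns to each edge a complex number of modulus $1$ such that the signed adjacency matrix $A(X^\sigma)$, with $(a,b)$-entry $\sigma(ab)$ if $ab\in E(X)$ and $0$ otherwise, is Hermitian (so $\sigma(ba)=\overline{\sigma(ab)}$). $X^\sigma$ denotes the resulting signed graph. For a graph $Y$ with vertex set $V$, $|V|=N$, states are unit vectors in $\mathbb{C}^V$, and $e_v$ denotes the standard basis vector of $v\in V$. For a Hermitian generator $H$ on $\mathbb{C}^V$ (the adjacency matrix of $Y$ or a positive real multiple of it), evolving for time $t\ge0$ maps $\psi$ to $e^{-itH}\psi$. The partial measurement relative to a vertex $a$ uses the projections $P_1=e_ae_a^T$ and $P_0=I-e_ae_a^T$: applied to a state $\psi$ it returns outcome $j\in\{0,1\}$ with probability $\|P_j\psi\|^2$, after which the state is $P_j\psi/\|P_j\psi\|$. A measured-walk protocol is an adaptive sequence of steps, each being either an evolution for some chosen time $t\ge 0$ or an (instantaneous) partial measurement relative to some chosen vertex, together with a stopping rule; all choices may depend on the start vertex and on previous measurement outcomes. Its total evolution time is the random variable given by the sum of the durations of the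 evolution steps before stopping. A state $\psi$ is uniform if $|\psi(v)|^2=1/N$ for all $v\in V$. Times are measured with the adjacency matrix scaled by $1/n$ (so that the generator has bounded norm). *)

theory Defs
  imports
    "HOL-Probability.SPMF"
    "HOL-Analysis.L2_Norm"
    "Jordan_Normal_Form.Schur_Decomposition"
begin

(* A simple graph on the vertex set {..<n} is given by n and its set of edges
   (two-element sets of vertices), so that C^V is carrier_vec n with e_v = unit_vec n v. *)

definition complete_edges :: "nat \<Rightarrow> nat set set" where
  "complete_edges n = {{a, b} | a b. a < n \<and> b < n \<and> a \<noteq> b}"

definition signed_adjacency ::
    "nat \<Rightarrow> nat set set \<Rightarrow> (nat \<Rightarrow> nat \<Rightarrow> complex) \<Rightarrow> complex mat" where
  "signed_adjacency n E \<sigma> = mat n n (\<lambda>(a, b). if {a, b} \<in> E then \<sigma> a b else 0)"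

definition unitary_signing ::
    "nat \<Rightarrow> nat set set \<Rightarrow> (nat \<Rightarrow> nat \<Rightarrow> complex) \<Rightarrow> bool" where
  "unitary_signing n E \<sigma> \<longleftrightarrow>
     (\<forall>a<n. \<forall>b<n. {a, b} \<in> E \<longrightarrow> cmod (\<sigma> a b) = 1) \<and>
     mat_adjoint (signed_adjacency n E \<sigma>) = signed_adjacency n E \<sigma>"

(* The exponential series, summed entrywise: the library has no exponential on this matrix type. *)
definition mat_exp :: "complex mat \<Rightarrow> complex mat" where
  "mat_exp A = mat (dim_row A) (dim_row A) (\<lambda>(i, j). \<Sum>k. (A ^\<^sub>m k) $$ (i, j) / fact k)"

definition evolve :: "complex mat \<Rightarrow> real \<Rightarrow> complex vec \<Rightarrow> complex vec" where
  "evolve H t \<psi> = mat_exp ((- \<i> * complex_of_real t) \<cdot>\<^sub>m H) *\<^sub>v \<psi>"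

definition vec_norm2 :: "complex vec \<Rightarrow> real" where
  "vec_norm2 \<psi> = L2_set (\<lambda>i. cmod (\<psi> $ i)) {..<dim_vec \<psi>}"

(* Measurement outcomes 1 and 0 are encoded as True and False. *)
definition projection :: "nat \<Rightarrow> nat \<Rightarrow> bool \<Rightarrow> complex mat" where
  "projection n a j =
     (let P1 = mat n n (\<lambda>(v, w). unit_vec n a $ v * unit_vec n a $ w)
      in if j then P1 else 1\<^sub>m n - P1)"

definition outcome_pmf :: "nat \<Rightarrow> complex vec \<Rightarrow> bool pmf" where
  "outcome_pmf a \<psi> = bernoulli_pmf ((vec_norm2 (projection (dim_vec \<psi>) a True *\<^sub>v \<psi>))\<^sup>2)"

definition post_measurement :: "nat \<Rightarrow> complex vec \<Rightarrow> bool \<Rightarrow> complex vec" where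
  "post_measurement a \<psi> j =
     (let \<phi> = projection (dim_vec \<psi>) a j *\<^sub>v \<psi>
      in complex_of_real (1 / vec_norm2 \<phi>) \<cdot>\<^sub>v \<phi>)"

(* The Bernoulli law gives both outcomes their Born probabilities on every state. *)
lemma pmf_outcome_pmf:
  assumes "vec_norm2 \<psi> = 1" and a: "a < dim_vec \<psi>"
  shows "pmf (outcome_pmf a \<psi>) j = (vec_norm2 (projection (dim_vec \<psi>) a j *\<^sub>v \<psi>))\<^sup>2"
proof -
  define n where "n = dim_vec \<psi>"
  have norm_sq: "(vec_norm2 \<phi>)\<^sup>2 = (\<Sum>i<n. (cmod (\<phi> $ i))\<^sup>2)" if "dim_vec \<phi> = n" for \<phi>
    using that by (simp add: vec_norm2_def L2_set_def sum_nonneg)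
  have P1: "projection n a True *\<^sub>v \<psi> = vec n (\<lambda>v. if v = a then \<psi> $ v else 0)"
    using a by (intro eq_vecI)
      (auto simp: projection_def n_def scalar_prod_def if_distrib[of "\<lambda>x. x * _"]
        sum.delta cong: if_cong)
  have "projection n a False *\<^sub>v \<psi> = 1\<^sub>m n *\<^sub>v \<psi> - projection n a True *\<^sub>v \<psi>"
    unfolding projection_def Let_def n_def
    by (simp add: minus_mult_distrib_mat_vec[where nr = "dim_vec \<psi>" and nc = "dim_vec \<psi>"]
          carrier_vec_dim_vec)
  then have P0: "projection n a False *\<^sub>v \<psi> = vec n (\<lambda>v. if v = a then 0 else \<psi> $ v)"
    unfolding P1 by (intro eq_vecI) (auto simp: n_def one_mult_mat_vec[OF carrier_vec_dim_vec])
  have s1: "(vec_norm2 (projection n a True *\<^sub>v \<psi>))\<^sup>2 = (cmod (\<psi> $ a))\<^sup>2"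
  proof -
    have "(\<Sum>v<n. (cmod (if v = a then \<psi> $ v else 0))\<^sup>2)
        = (\<Sum>v<n. if v = a then (cmod (\<psi> $ v))\<^sup>2 else 0)"
      by (intro sum.cong) auto
    also have "\<dots> = (cmod (\<psi> $ a))\<^sup>2" using a by (simp add: n_def)
    finally show ?thesis by (simp add: P1 norm_sq)
  qed
  have "(\<Sum>v<n. (cmod (\<psi> $ v))\<^sup>2) = 1"
    using assms norm_sq[of \<psi>] by (simp add: n_def)
  moreover have "(\<Sum>v<n. (cmod (\<psi> $ v))\<^sup>2)
      = (cmod (\<psi> $ a))\<^sup>2 + (\<Sum>v<n. (cmod (if v = a then 0 else \<psi> $ v))\<^sup>2)"
  proof -
    have "(\<Sum>v<n. (cmod (if v = a then 0 else \<psi> $ v))\<^sup>2)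
        = (\<Sum>v\<in>{..<n} - {a}. (cmod (\<psi> $ v))\<^sup>2)"
      by (intro sum.mono_neutral_cong_right) auto
    then show ?thesis
      using a by (simp add: n_def sum.remove[of "{..<dim_vec \<psi>}" a])
  qed
  ultimately have sum: "(cmod (\<psi> $ a))\<^sup>2 + (vec_norm2 (projection n a False *\<^sub>v \<psi>))\<^sup>2 = 1"
    by (simp add: P0 norm_sq)
  have "(cmod (\<psi> $ a))\<^sup>2 \<le> 1"
    using sum by (metis le_add_same_cancel1 zero_le_power2)
  then show ?thesis
    using sum s1 by (cases j) (auto simp: outcome_pmf_def n_def)
qed

definition uniform_state :: "complex vec \<Rightarrow> bool" where
  "uniform_state \<psi> \<longleftrightarrow> (\<forall>v<dim_vec \<psi>. (cmod (\<psi> $ v))\<^sup>2 = 1 / real (dim_vec \<psi>))"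

(* A protocol is a possibly infinite decision tree that branches on measurement outcomes. *)
codatatype protocol =
    Stop
  | Evolve real protocol
  | Measure nat "bool \<Rightarrow> protocol"

coinductive valid_protocol :: "nat \<Rightarrow> protocol \<Rightarrow> bool" for n where
  "valid_protocol n Stop"
| "t \<ge> 0 \<Longrightarrow> valid_protocol n p \<Longrightarrow> valid_protocol n (Evolve t p)"
| "a < n \<Longrightarrow> (\<And>j. valid_protocol n (q j)) \<Longrightarrow> valid_protocol n (Measure a q)"

(* Joint law of the final state and the total evolution time, where s is the time already
   elapsed. The missing mass is the probability that the protocol never stops. *)
partial_function (spmf) run_protocol ::
    "complex mat \<Rightarrow> protocol \<Rightarrow> complex vec \<Rightarrow> real \<Rightarrow> (complex vec \<times> real) spmf" where
  "run_protocol H p \<psi> s =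
     (case p of
        Stop \<Rightarrow> return_spmf (\<psi>, s)
      | Evolve t p' \<Rightarrow> run_protocol H p' (evolve H t \<psi>) (s + t)
      | Measure a q \<Rightarrow>
          bind_pmf (outcome_pmf a \<psi>) (\<lambda>j. run_protocol H (q j) (post_measurement a \<psi> j) s))"

(* The expectation is taken in [0, \<infinity>], so a finite bound includes its existence. *)
definition las_vegas_uniform_mixing :: "complex mat \<Rightarrow> real \<Rightarrow> bool" where
  "las_vegas_uniform_mixing H T \<longleftrightarrow>
     (\<forall>u<dim_row H. \<exists>p. valid_protocol (dim_row H) p \<and>
        (let law = run_protocol H p (unit_vec (dim_row H) u) 0 in
           lossless_spmf law \<and>
           (\<forall>(\<psi>, s)\<in>set_spmf law. uniform_state \<psi>) \<and>
           (\<integral>\<^sup>+ (\<psi>, s). ennreal s \<partial>measure_spmf law) \<le> ennreal T))"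

end

theory Submission
  imports Defs
begin

text \<open>
  The trivial signing already suffices, in expected time \<open>O(n)\<close>. The generator \<open>(J - I) / n\<close> is, up to
  a global phase, the projection \<open>J / n\<close> onto the constants, so time \<open>\<pi>\<close> reflects in the orthogonal
  complement of the constants, and the walker from \<open>u\<close> leaves \<open>u\<close> with probability
  \<open>1 - (1 - 2/n)\<^sup>2 \<ge> 1/n\<close>. If the measurement at \<open>u\<close> finds it there, the state is \<open>e\<^sub>u\<close> again
  up to phase and the round is repeated; otherwise the state is constant off \<open>u\<close> and vanishes at \<open>u\<close>.
  From the latter state the walk reaches an amplitude of modulus \<open>1 / sqrt n\<close> at \<open>u\<close> when
  \<open>\<bar>exp (-i t) - 1\<bar>\<^sup>2 = n / (n - 1)\<close>, and then the remaining, mutually equal amplitudes have that modulus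
  too.
\<close>

(* Otherwise $ is ambiguous with the component notation of HOL-Analysis. *)
unbundle no vec_syntax

section \<open>The protocol as an infinite decision tree\<close>

text \<open>A round consists of two constructors, an evolution and a measurement. The flag
  \<open>walked\<close> tells which of them comes next, so that every corecursive call is guarded by
  exactly one constructor.\<close>

primcorec mixing_protocol :: "nat \<Rightarrow> real \<Rightarrow> bool \<Rightarrow> protocol" where
  "mixing_protocol u \<tau> walked =
     (if walked
      then Measure u (\<lambda>j. if j then mixing_protocol u \<tau> False else Evolve \<tau> Stop)
      else Evolve pi (mixing_protocol u \<tau> True))"

lemma mixing_protocol_simps:
  "mixing_protocol u \<tau> False = Evolve pi (mixing_protocol u \<tau> True)"
  "mixing_protocol u \<tau> True =
    Measure u (\<lambda>j. if j then mixing_protocol u \<tau> False else Evolve \<tau> Stop)"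
  by (subst mixing_protocol.code, simp)+

lemma valid_mixing_protocol:
  assumes "u < n" "\<tau> \<ge> 0"
  shows "valid_protocol n (mixing_protocol u \<tau> walked)"
proof (coinduction arbitrary: walked)
  case valid_protocol
  \<comment> \<open>The closing branch is not itself of the form \<open>mixing_protocol\<close>, so
    its validity is supplied outside the coinduction.\<close>
  have "valid_protocol n (Evolve \<tau> Stop)"
    using assms by (intro valid_protocol.intros)
  then show ?case
    using assms by (cases walked; subst mixing_protocol.code) auto
qed

section \<open>Loops with a geometric number of rounds\<close>

lemma nn_integral_spmf_bind_pmf:
  "(\<integral>\<^sup>+ y. g y \<partial>measure_spmf (bind_pmf M f)) =
    (\<integral>\<^sup>+ x. \<integral>\<^sup>+ y. g y \<partial>measure_spmf (f x) \<partial>measure_pmf M)"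
  unfolding measure_spmf_bind_pmf o_def
  by (subst nn_integral_bind[where B = "count_space UNIV"])
    (auto simp: space_subprob_algebra measure_spmf.subprob_space_axioms subprob_space_measure_spmf)

text \<open>The repetition probability \<open>q\<close> is the same in every round, but the state
  may change: in the walk, a failed round adds a global phase and elapsed time. Everything is
  derived by iterating the equation \<open>unfold\<close>.\<close>

locale geometric_loop =
  fixes L :: "'s \<Rightarrow> 'x spmf" and q :: real
    and X :: "'s set" and nxt :: "'s \<Rightarrow> 's" and out :: "'s \<Rightarrow> 'x"
  assumes unfold: "x \<in> X \<Longrightarrow>
      L x = bind_pmf (bernoulli_pmf q) (\<lambda>j. if j then L (nxt x) else return_spmf (out x))"
    and nxt: "x \<in> X \<Longrightarrow> nxt x \<in> X"
    and q: "0 \<le> q" "q < 1"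
begin

lemma nn_integral_unfold:
  assumes "x \<in> X"
  shows "(\<integral>\<^sup>+ y. g y \<partial>measure_spmf (L x)) =
    ennreal q * (\<integral>\<^sup>+ y. g y \<partial>measure_spmf (L (nxt x))) + ennreal (1 - q) * g (out x)"
  using q by (subst unfold[OF assms], subst nn_integral_spmf_bind_pmf)
    (simp add: measure_spmf_return_spmf nn_integral_return mult.commute)

lemma measure_out:
  assumes "x \<in> X"
  shows "measure (measure_spmf (L x)) (out ` X) = 1"
proof (rule antisym)
  have "ennreal (1 - q ^ k) \<le> (\<integral>\<^sup>+ y. indicator (out ` X) y \<partial>measure_spmf (L x))" for k
    using assms
  proof (induction k arbitrary: x)
    case (Suc k)
    have "ennreal (1 - q ^ Suc k) = ennreal q * ennreal (1 - q ^ k) + ennreal (1 - q) * 1"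
    proof -
      have "1 - q ^ Suc k = q * (1 - q ^ k) + (1 - q) * 1"
        by (simp add: algebra_simps)
      then show ?thesis
        using q by (simp only: ennreal_plus ennreal_mult power_le_one mult_nonneg_nonneg diff_ge_0_iff_ge
            less_imp_le zero_le_one order_refl ennreal_1)
    qed
    also have "\<dots> \<le> ennreal q * (\<integral>\<^sup>+ y. indicator (out ` X) y \<partial>measure_spmf (L (nxt x)))
        + ennreal (1 - q) * indicator (out ` X) (out x)"
      using Suc nxt by (intro add_mono mult_left_mono) auto
    finally show ?case using nn_integral_unfold[OF Suc.prems] by simp
  qed simp
  then have "1 - q ^ k \<le> measure (measure_spmf (L x)) (out ` X)" for k
    by (simp add: measure_spmf.emeasure_eq_measure ennreal_le_iff)
  moreover have "(\<lambda>k. 1 - q ^ k) \<longlonglongrightarrow> 1 - 0"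
    using q by (intro tendsto_intros LIMSEQ_realpow_zero) auto
  ultimately show "1 \<le> measure (measure_spmf (L x)) (out ` X)"
    using LIMSEQ_le_const2[of "\<lambda>k. 1 - q ^ k" 1] by simp
qed (rule measure_spmf.subprob_measure_le_1)

lemma lossless:
  assumes "x \<in> X"
  shows "lossless_spmf (L x)"
  using measure_out[OF assms] measure_spmf.bounded_measure[of "L x" "out ` X"] weight_spmf_le_1[of "L x"]
  by (simp add: lossless_spmf_def weight_spmf_def)

lemma set_spmf_subset:
  assumes "x \<in> X"
  shows "set_spmf (L x) \<subseteq> out ` X"
proof -
  have "measure (measure_spmf (L x)) (UNIV - out ` X) = 0"
    using measure_spmf.finite_measure_compl[of "out ` X" "L x"] measure_out[OF assms] lossless[OF assms]
    by (simp add: lossless_spmf_def weight_spmf_def space_measure_spmf)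
  then show ?thesis
    by (auto simp: measure_spmf_zero_iff)
qed

text \<open>Here \<open>h\<close> is the cost accumulated so far, \<open>d\<close> the cost of a
  repeated round and \<open>e\<close> that of the last one; the mean number of repetitions is
  \<open>q / (1 - q)\<close>.\<close>

lemma nn_integral_le:
  fixes f :: "'x \<Rightarrow> ennreal" and h :: "'s \<Rightarrow> real"
  assumes x: "x \<in> X"
    and h: "\<And>x. x \<in> X \<Longrightarrow> 0 \<le> h x" "\<And>x. x \<in> X \<Longrightarrow> h (nxt x) = h x + d"
    and f: "\<And>x. x \<in> X \<Longrightarrow> f (out x) \<le> ennreal (h x + e)"
    and de: "0 \<le> d" "0 \<le> e"
  shows "(\<integral>\<^sup>+ y. f y \<partial>measure_spmf (L x)) \<le> ennreal (h x + e + d * q / (1 - q))"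
proof -
  define B where "B = e + d * q / (1 - q)"
  \<comment> \<open>The expected remaining cost is the fixed point of the one-round recursion; this
    identity closes the induction below.\<close>
  have B: "q * (d + B) + (1 - q) * e = B"
    using q by (simp add: B_def field_simps)
  have B0: "0 \<le> B"
    using q de by (simp add: B_def)
  text \<open>A finite cutoff makes the term that remains after \<open>k\<close> rounds finite, hence of order \<open>q ^ k\<close>.\<close>
  have trunc: "(\<integral>\<^sup>+ y. min (f y) (of_nat K) \<partial>measure_spmf (L x)) \<le> ennreal (h x + B)" for K :: nat
  proof -
    have "(\<integral>\<^sup>+ y. min (f y) (of_nat K) \<partial>measure_spmf (L x)) \<le> ennreal (h x + B + q ^ k * K)" for k
      using x
    proof (induction k arbitrary: x)
      case 0
      have "(\<integral>\<^sup>+ y. min (f y) (of_nat K) \<partial>measure_spmf (L x)) \<le> (\<integral>\<^sup>+ y. of_nat K \<partial>measure_spmf (L x))"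
        by (intro nn_integral_mono) simp
      also have "\<dots> \<le> of_nat K"
        using mult_left_mono[OF measure_spmf.emeasure_space_le_1[of "L x"], of "of_nat K"] by simp
      also have "\<dots> \<le> ennreal (h x + B + q ^ 0 * K)"
        using h(1)[OF 0] B0 by (simp add: ennreal_of_nat_eq_real_of_nat del: ennreal_plus)
      finally show ?case .
    next
      case (Suc k)
      have nn: "0 \<le> h x" "0 \<le> q ^ k * K" using h(1)[OF Suc.prems] q by auto
      have "(\<integral>\<^sup>+ y. min (f y) (of_nat K) \<partial>measure_spmf (L x)) \<le>
          ennreal q * ennreal (h (nxt x) + B + q ^ k * K) + ennreal (1 - q) * ennreal (h x + e)"
        unfolding nn_integral_unfold[OF Suc.prems, of "\<lambda>y. min (f y) (of_nat K)"]
        using f[OF Suc.prems] by (intro add_mono mult_left_mono Suc.IH nxt Suc.prems) (auto intro: min.coboundedI1)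
      also have "\<dots> = ennreal (q * (h x + d + B + q ^ k * K) + (1 - q) * (h x + e))"
        using nn q B0 de h(2)[OF Suc.prems]
        by (simp add: ennreal_mult[symmetric] ennreal_plus[symmetric] del: ennreal_plus)
      also have "q * (h x + d + B + q ^ k * K) + (1 - q) * (h x + e) =
          h x + (q * (d + B) + (1 - q) * e) + q ^ Suc k * K"
        by (simp add: algebra_simps)
      finally show ?case unfolding B .
    qed
    moreover have "(\<lambda>k. ennreal (h x + B + q ^ k * K)) \<longlonglongrightarrow> ennreal (h x + B + 0 * real K)"
      by (intro tendsto_ennrealI tendsto_add tendsto_mult tendsto_const LIMSEQ_realpow_zero q)
    ultimately show ?thesis
      by (intro LIMSEQ_le_const[where X = "\<lambda>k. ennreal (h x + B + q ^ k * K)"]) auto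
  qed
  \<comment> \<open>Since \<open>trunc\<close> is uniform in \<open>K\<close>, monotone convergence
    removes the cutoff.\<close>
  have "f y = (SUP K::nat. min (f y) (of_nat K))" for y
    using inf_SUP[of "f y" of_nat UNIV] by (simp add: inf_min ennreal_SUP_of_nat_eq_top)
  then have "(\<integral>\<^sup>+ y. f y \<partial>measure_spmf (L x)) = (\<integral>\<^sup>+ y. (SUP K::nat. min (f y) (of_nat K)) \<partial>measure_spmf (L x))"
    by simp
  also have "\<dots> = (SUP K::nat. \<integral>\<^sup>+ y. min (f y) (of_nat K) \<partial>measure_spmf (L x))"
    by (intro nn_integral_monotone_convergence_SUP) (auto simp: incseq_def le_fun_def intro: min.coboundedI2)
  also have "\<dots> \<le> ennreal (h x + B)"
    using trunc by (intro SUP_least) auto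
  finally show ?thesis by (simp add: B_def add.assoc)
qed

end

section \<open>Spectral calculus for the complete graph\<close>

text \<open>The matrix with eigenvalue \<open>a\<close> on the constants and \<open>b\<close> on their orthogonal complement.\<close>
definition const_spectral :: "nat \<Rightarrow> complex \<Rightarrow> complex \<Rightarrow> complex mat" where
  "const_spectral n a b = mat n n (\<lambda>(i, j). (a - b) / of_nat n + (if i = j then b else 0))"

lemma dim_const_spectral [simp]:
  "dim_row (const_spectral n a b) = n" "dim_col (const_spectral n a b) = n"
  by (simp_all add: const_spectral_def)

lemma const_spectral_one: "const_spectral n 1 1 = 1\<^sub>m n"
  by (intro eq_matI) (auto simp: const_spectral_def)

lemma const_spectral_smult: "z \<cdot>\<^sub>m const_spectral n a b = const_spectral n (z * a) (z * b)"
  by (intro eq_matI) (auto simp: const_spectral_def algebra_simps diff_divide_distrib)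

text \<open>Both factors have the same two eigenspaces, so the eigenvalues multiply.\<close>

lemma const_spectral_mult:
  "const_spectral n a b * const_spectral n c d = const_spectral n (a * c) (b * d)"
proof (intro eq_matI)
  fix i j assume "i < dim_row (const_spectral n (a * c) (b * d))"
    "j < dim_col (const_spectral n (a * c) (b * d))"
  then have ij: "i < n" "j < n" by auto
  define a' c' where "a' = (a - b) / of_nat n" and "c' = (c - d) / of_nat n"
  have "(const_spectral n a b * const_spectral n c d) $$ (i, j) =
      (\<Sum>k<n. (a' + (if i = k then b else 0)) * (c' + (if k = j then d else 0)))"
    using ij by (auto simp: const_spectral_def scalar_prod_def a'_def c'_def atLeast0LessThan intro!: sum.cong)
  \<comment> \<open>Each summand is given at most one condition on \<open>k\<close>, so the sums
    collapse separately.\<close>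
  also have "\<dots> = (\<Sum>k<n. a' * c' + (if k = j then a' * d else 0) + (if i = k then b * c' else 0)
      + (if i = k then (if i = j then b * d else 0) else 0))"
    by (intro sum.cong) (auto simp: algebra_simps)
  also have "\<dots> = of_nat n * a' * c' + a' * d + b * c' + (if i = j then b * d else 0)"
    using ij by (simp add: sum.distrib)
  also have "\<dots> = const_spectral n (a * c) (b * d) $$ (i, j)"
    using ij by (simp add: const_spectral_def a'_def c'_def field_simps)
  finally show "(const_spectral n a b * const_spectral n c d) $$ (i, j) =
      const_spectral n (a * c) (b * d) $$ (i, j)" .
qed auto

lemma const_spectral_power: "const_spectral n a b ^\<^sub>m k = const_spectral n (a ^ k) (b ^ k)"
  by (induction k) (simp_all add: const_spectral_one const_spectral_mult mult.commute)

text \<open>Powers act on the two eigenvalues, so each entry of the series is a linear combination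
  of two scalar exponential series.\<close>

lemma mat_exp_const_spectral: "mat_exp (const_spectral n a b) = const_spectral n (exp a) (exp b)"
proof (intro eq_matI)
  fix i j assume "i < dim_row (const_spectral n (exp a) (exp b))"
    "j < dim_col (const_spectral n (exp a) (exp b))"
  then have ij: "i < n" "j < n" by auto
  have *: "(\<lambda>k. x ^ k / fact k) sums exp x" for x :: complex
    using exp_converges[of x] by (simp add: scaleR_conv_of_real field_simps)
  have "(\<lambda>k. (a ^ k / fact k - b ^ k / fact k) / of_nat n + (if i = j then 1 else 0) * (b ^ k / fact k))
      sums ((exp a - exp b) / of_nat n + (if i = j then 1 else 0) * exp b)"
    by (intro sums_add sums_divide sums_diff sums_mult *)
  then have "(\<lambda>k. const_spectral n (a ^ k) (b ^ k) $$ (i, j) / fact k)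
      sums (const_spectral n (exp a) (exp b) $$ (i, j))"
    using ij by (cases "i = j") (simp_all add: const_spectral_def diff_divide_distrib add_divide_distrib
        mult.commute)
  then show "mat_exp (const_spectral n a b) $$ (i, j) = const_spectral n (exp a) (exp b) $$ (i, j)"
    using ij by (simp add: mat_exp_def const_spectral_power sums_iff)
qed (auto simp: mat_exp_def)

text \<open>The adjacency matrix J - I has eigenvalue n - 1 on the constants and -1 on their
  orthogonal complement.\<close>

lemma complete_hamiltonian_eq:
  assumes "n > 0"
  shows "complex_of_real (1 / real n) \<cdot>\<^sub>m signed_adjacency n (complete_edges n) (\<lambda>_ _. 1) =
    const_spectral n (1 - 1 / of_nat n) (- 1 / of_nat n)"
  using assms
  by (intro eq_matI) (auto simp: signed_adjacency_def complete_edges_def const_spectral_def doubleton_eq_iff)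

lemma unitary_signing_one: "unitary_signing n (complete_edges n) (\<lambda>_ _. 1)"
  by (auto simp: unitary_signing_def signed_adjacency_def mat_adjoint_def insert_commute
      mat_of_rows_index intro!: eq_matI)

text \<open>The evolution operator is \<open>cis (t / n)\<close> times I + (exp(-it) - 1) J/n, since
  the two eigenvalues of the generator differ by 1.\<close>

lemma evolve_complete:
  assumes "n > 0" "\<psi> \<in> carrier_vec n"
  shows "evolve (const_spectral n (1 - 1 / of_nat n) (- 1 / of_nat n)) t \<psi> =
    vec n (\<lambda>i. cis (t / n) * (\<psi> $ i + (cis (- t) - 1) * (\<Sum>j<n. \<psi> $ j) / of_nat n))"
proof -
  define b where "b = cis (t / n)"
  have 1: "exp (- \<i> * complex_of_real t * (- 1 / of_nat n)) = b"
    by (simp add: cis_conv_exp b_def)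
  have 2: "exp (- \<i> * complex_of_real t * (1 - 1 / of_nat n)) = b * cis (- t)"
    by (simp add: cis_conv_exp b_def exp_add[symmetric] algebra_simps)
  have "(const_spectral n (b * cis (- t)) b *\<^sub>v \<psi>) $ i =
      b * (\<psi> $ i + (cis (- t) - 1) * (\<Sum>j<n. \<psi> $ j) / of_nat n)" if "i < n" for i
  proof -
    have "(const_spectral n (b * cis (- t)) b *\<^sub>v \<psi>) $ i =
        (\<Sum>j<n. (b * cis (- t) - b) / of_nat n * \<psi> $ j + (if i = j then b * \<psi> $ j else 0))"
      using that assms
      by (auto simp: const_spectral_def scalar_prod_def atLeast0LessThan distrib_right
          simp del: sum.delta sum.delta' intro!: sum.cong)
    also have "\<dots> = (b * cis (- t) - b) / of_nat n * (\<Sum>j<n. \<psi> $ j) + b * \<psi> $ i"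
      using that by (simp add: sum.distrib sum_distrib_left)
    finally show ?thesis by (simp add: algebra_simps add_divide_distrib diff_divide_distrib)
  qed
  then show ?thesis
    unfolding evolve_def const_spectral_smult mat_exp_const_spectral 1 2
    by (intro eq_vecI) (simp_all add: b_def)
qed

section \<open>Partial measurements of explicit vectors\<close>

lemma projection_True_mult:
  assumes "a < n"
  shows "projection n a True *\<^sub>v vec n f = vec n (\<lambda>v. if v = a then f a else 0)"
  using assms by (intro eq_vecI)
    (auto simp: projection_def scalar_prod_def if_distrib[of "\<lambda>x. x * _"] cong: if_cong)

lemma projection_False_mult:
  assumes "a < n"
  shows "projection n a False *\<^sub>v vec n f = vec n (\<lambda>v. if v = a then 0 else f v)"
proof -
  have "projection n a False *\<^sub>v vec n f = 1\<^sub>m n *\<^sub>v vec n f - projection n a True *\<^sub>v vec n f"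
    unfolding projection_def Let_def
    by (simp add: minus_mult_distrib_mat_vec[where nr = n and nc = n])
  then show ?thesis
    using assms by (intro eq_vecI) (auto simp: projection_True_mult)
qed

lemma vec_norm2_single: "a < n \<Longrightarrow> vec_norm2 (vec n (\<lambda>v. if v = a then x else 0)) = cmod x"
  by (simp add: vec_norm2_def L2_set_def if_distrib[of "\<lambda>x. (cmod x)\<^sup>2"] cong: if_cong)

lemma vec_norm2_const_except:
  assumes "a < n"
  shows "vec_norm2 (vec n (\<lambda>v. if v = a then 0 else x)) = sqrt (real (n - 1)) * cmod x"
proof -
  have "(\<Sum>v<n. (cmod (if v = a then 0 else x))\<^sup>2) = (\<Sum>v\<in>{..<n} - {a}. (cmod x)\<^sup>2)"
    by (intro sum.mono_neutral_cong_right) auto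
  then show ?thesis
    using assms by (simp add: vec_norm2_def L2_set_def real_sqrt_mult)
qed

section \<open>One round of the walk and the final evolution\<close>

text \<open>The time \<open>t\<close> with \<open>\<bar>exp (-i t) - 1\<bar>\<^sup>2 = n / (n - 1)\<close>.\<close>
definition hit_time :: "nat \<Rightarrow> real" where
  "hit_time n = arccos ((real n - 2) / (2 * (real n - 1)))"

text \<open>The unimodular \<open>c\<close> is the global phase left over from earlier
  evolutions.\<close>

context
  fixes n u :: nat and c :: complex
  assumes n: "n \<ge> 5" and u: "u < n" and c: "cmod c = 1"
begin

private lemma cis_pi_minus: "cis (- pi) = - 1"
  by (simp add: complex_eq_iff)

text \<open>Ensures that the amplitude \<open>1 - 2 / n\<close> at \<open>u\<close> is nonzero, so
  that outcome 1 can be normalized.\<close>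

private lemma of_nat_n_neq: "complex_of_nat n \<noteq> 2"
  using n of_nat_eq_iff[where ?'a = complex, of n 2] by simp

private lemma cmod_stay [simp]: "cmod (1 - 2 / of_nat n) = 1 - 2 / real n"
proof -
  have "1 - 2 / of_nat n = complex_of_real (1 - 2 / real n)" by simp
  then show ?thesis using n by (simp only: norm_of_real) (simp add: field_simps)
qed

text \<open>At time \<open>pi\<close> the factor exp(-it) - 1 is -2, so up to phase the state is a
  column of the reflection I - 2J/n.\<close>

lemma evolve_pi_basis:
  "evolve (const_spectral n (1 - 1 / of_nat n) (- 1 / of_nat n)) pi (c \<cdot>\<^sub>v unit_vec n u) =
    vec n (\<lambda>i. c * cis (pi / n) * (if i = u then of_real (1 - 2 / real n) else of_real (- 2 / real n)))"
proof -
  have "(\<Sum>j<n. (c \<cdot>\<^sub>v unit_vec n u) $ j) = c"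
    using u by (simp add: if_distrib[of "\<lambda>x. _ * x"] cong: if_cong)
  then show ?thesis
    using n u by (subst evolve_complete) (auto simp: cis_pi_minus algebra_simps intro!: eq_vecI)
qed

lemma outcome_pmf_basis:
  "outcome_pmf u (vec n (\<lambda>i. c * (if i = u then of_real (1 - 2 / real n) else of_real (- 2 / real n)))) =
    bernoulli_pmf ((1 - 2 / real n)\<^sup>2)"
  using u c unfolding outcome_pmf_def
  by (simp add: projection_True_mult cong: if_cong)
    (simp add: vec_norm2_single norm_mult)

text \<open>The amplitude at \<open>u\<close> is \<open>c\<close> times a positive real, so
  normalization keeps the phase \<open>c\<close> and a new round can start.\<close>

lemma post_measurement_True_basis:
  "post_measurement u (vec n (\<lambda>i. c * (if i = u then of_real (1 - 2 / real n) else of_real (- 2 / real n)))) True =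
    c \<cdot>\<^sub>v unit_vec n u"
  using u c n unfolding post_measurement_def
  by (simp add: projection_True_mult Let_def cong: if_cong)
    (auto simp: vec_norm2_single norm_mult of_nat_n_neq intro!: eq_vecI)

text \<open>The n - 1 surviving amplitudes all equal -2c/n; dividing by their norm, 2/n times the
  root of n - 1, leaves only sign and phase.\<close>

lemma post_measurement_False_basis:
  "post_measurement u (vec n (\<lambda>i. c * (if i = u then of_real (1 - 2 / real n) else of_real (- 2 / real n)))) False =
    vec n (\<lambda>i. if i = u then 0 else - c / of_real (sqrt (real n - 1)))"
  using u c n unfolding post_measurement_def
  by (simp add: projection_False_mult Let_def cong: if_cong)
    (auto simp: vec_norm2_const_except norm_mult norm_divide of_nat_diff intro!: eq_vecI)

text \<open>The squared modulus at \<open>u\<close> becomes |x|^2 r^2/n^2 and elsewhere |1 +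
  xa|^2/r^2. With |x|^2 = 1/a and a = r^2/n both equal 1/n.\<close>

lemma uniform_evolve_rest:
  "uniform_state (evolve (const_spectral n (1 - 1 / of_nat n) (- 1 / of_nat n)) (hit_time n)
    (vec n (\<lambda>i. if i = u then 0 else - c / of_real (sqrt (real n - 1)))))"
  (is "uniform_state (evolve _ _ ?w)")
proof -
  \<comment> \<open>This is the squared norm of the projection of the start vector onto the
    constants.\<close>
  define a where "a = (real n - 1) / real n"
  define r where "r = sqrt (real n - 1)"
  define x where "x = cis (- hit_time n) - 1"
  have r: "r > 0" "r\<^sup>2 = real n - 1" "r * r = real n - 1" using n by (auto simp: r_def)
  have a: "a > 0" using n by (simp add: a_def)
  have "cos (hit_time n) = (real n - 2) / (2 * (real n - 1))"
    unfolding hit_time_def using n by (intro cos_arccos) (auto simp: field_simps)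
  \<comment> \<open>As |x|^2 = 2 - 2 cos t, this form says exactly that |x|^2 = 1/a.\<close>
  then have cos: "cos (hit_time n) = 1 - 1 / (2 * a)"
    using n by (simp add: a_def field_simps)
  have Re: "Re x = - 1 / (2 * a)" using cos by (simp add: x_def)
  have Im: "(Im x)\<^sup>2 = 1 - (1 - 1 / (2 * a))\<^sup>2"
    using cos sin_cos_squared_add[of "hit_time n"] by (simp add: x_def)
  have xu: "(cmod x)\<^sup>2 = 1 / a"
    unfolding cmod_power2 Re Im using a by (simp add: power2_eq_square field_simps)
  have xv: "(cmod (1 + x * of_real a))\<^sup>2 = a"
  proof -
    \<comment> \<open>Since 2a Re x = -1, the first two terms cancel and the last one is a.\<close>
    have "(cmod (1 + x * of_real a))\<^sup>2 = 1 + 2 * a * Re x + a\<^sup>2 * (cmod x)\<^sup>2"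
      unfolding cmod_power2 by (simp add: power2_eq_square algebra_simps)
    then show ?thesis
      using a unfolding xu Re by (simp add: power2_eq_square)
  qed
  have "(\<Sum>j<n. ?w $ j) = (\<Sum>j\<in>{..<n} - {u}. - c / of_real r)"
    by (intro sum.mono_neutral_cong_right) (auto simp: r_def)
  also have "\<dots> = - c * of_real r"
  proof -
    have "of_nat (n - 1) = complex_of_real r * complex_of_real r"
      unfolding of_real_mult[symmetric] r(3) using n by (simp add: of_nat_diff)
    then show ?thesis
      using u r by simp
  qed
  finally have sum: "(\<Sum>j<n. ?w $ j) = - c * of_real r" .
  have "(cmod (cis (hit_time n / n) * (?w $ i + x * (- c * of_real r) / of_nat n)))\<^sup>2 = 1 / real n"
    if "i < n" for i
  proof (cases "i = u")
    case True
    have "(cmod (x * (- c * of_real r) / of_nat n))\<^sup>2 = (cmod x)\<^sup>2 * r\<^sup>2 / (real n)\<^sup>2"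
      using c r by (simp add: norm_mult norm_divide power_mult_distrib power_divide)
    then show ?thesis
      using True that n r unfolding norm_mult[of "cis _"] xu by (simp add: a_def power2_eq_square)
  next
    case False
    have "?w $ i + x * (- c * of_real r) / of_nat n = - c / of_real r * (1 + x * of_real (r\<^sup>2 / n))"
      using False that r(1) by (simp add: r_def[symmetric] field_simps power2_eq_square)
    also have "r\<^sup>2 / n = a" using r by (simp add: a_def)
    finally have "(cmod (?w $ i + x * (- c * of_real r) / of_nat n))\<^sup>2 = 1 / r\<^sup>2 * (cmod (1 + x * of_real a))\<^sup>2"
      using c r by (simp add: norm_mult norm_divide power_mult_distrib power_divide)
    also have "\<dots> = 1 / real n"
      using n unfolding xv r(2) by (simp add: a_def)
    finally show ?thesis by (simp add: norm_mult)
  qed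
  moreover have "evolve (const_spectral n (1 - 1 / of_nat n) (- 1 / of_nat n)) (hit_time n) ?w =
      vec n (\<lambda>i. cis (hit_time n / n) * (?w $ i + x * (- c * of_real r) / of_nat n))"
    using n by (subst evolve_complete) (simp_all only: sum x_def vec_carrier)
  ultimately show ?thesis
    by (simp only: uniform_state_def dim_vec, intro allI impI, simp only: index_vec)
qed

end

section \<open>The law of the protocol and its expected time\<close>

text \<open>This is one round in the shape of \<open>unfold\<close> for
  \<open>geometric_loop\<close>, with loop state \<open>(c, s)\<close>: the probability of repeating
  depends on neither phase nor elapsed time.\<close>

lemma run_mixing_protocol:
  assumes n: "n \<ge> 5" and u: "u < n" and c: "cmod c = 1"
    and H: "H = const_spectral n (1 - 1 / of_nat n) (- 1 / of_nat n)"
  shows "run_protocol H (mixing_protocol u \<tau> False) (c \<cdot>\<^sub>v unit_vec n u) s =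
    bind_pmf (bernoulli_pmf ((1 - 2 / real n)\<^sup>2)) (\<lambda>j.
      if j then run_protocol H (mixing_protocol u \<tau> False) ((c * cis (pi / n)) \<cdot>\<^sub>v unit_vec n u) (s + pi)
      else return_spmf (evolve H \<tau>
        (vec n (\<lambda>i. if i = u then 0 else - (c * cis (pi / n)) / of_real (sqrt (real n - 1)))), s + pi + \<tau>))"
proof -
  let ?c = "c * cis (pi / n)"
  let ?\<phi> = "vec n (\<lambda>i. ?c * (if i = u then of_real (1 - 2 / real n) else of_real (- 2 / real n)))"
  have c': "cmod ?c = 1" using c by (simp add: norm_mult)
  have "run_protocol H (mixing_protocol u \<tau> False) (c \<cdot>\<^sub>v unit_vec n u) s =
      run_protocol H (mixing_protocol u \<tau> True) ?\<phi> (s + pi)"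
    by (subst run_protocol.simps, subst mixing_protocol_simps) (simp only: protocol.case H evolve_pi_basis[OF n u c])
  also have "\<dots> = bind_pmf (bernoulli_pmf ((1 - 2 / real n)\<^sup>2)) (\<lambda>j.
      run_protocol H (if j then mixing_protocol u \<tau> False else Evolve \<tau> Stop) (post_measurement u ?\<phi> j) (s + pi))"
    by (subst run_protocol.simps, subst mixing_protocol_simps)
      (simp only: outcome_pmf_basis[OF n u c'] protocol.case)
  also have "\<dots> = bind_pmf (bernoulli_pmf ((1 - 2 / real n)\<^sup>2)) (\<lambda>j.
      if j then run_protocol H (mixing_protocol u \<tau> False) (?c \<cdot>\<^sub>v unit_vec n u) (s + pi)
      else return_spmf (evolve H \<tau>
        (vec n (\<lambda>i. if i = u then 0 else - ?c / of_real (sqrt (real n - 1)))), s + pi + \<tau>))"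
  proof (intro bind_pmf_cong refl)
    fix j
    have "run_protocol H (Evolve \<tau> Stop) \<psi> r = return_spmf (evolve H \<tau> \<psi>, r + \<tau>)" for \<psi> r
      by (simp add: run_protocol.simps)
    then show "run_protocol H (if j then mixing_protocol u \<tau> False else Evolve \<tau> Stop) (post_measurement u ?\<phi> j)
        (s + pi) =
      (if j then run_protocol H (mixing_protocol u \<tau> False) (?c \<cdot>\<^sub>v unit_vec n u) (s + pi)
      else return_spmf (evolve H \<tau>
        (vec n (\<lambda>i. if i = u then 0 else - ?c / of_real (sqrt (real n - 1)))), s + pi + \<tau>))"
      using post_measurement_True_basis[OF n u c'] post_measurement_False_basis[OF n u c']
      by (cases j) (simp_all only: if_True if_False)
  qed
  finally show ?thesis .
qed

text \<open>The mean number of rounds is 1/(1 - q) = n^2/(4(n - 1)), at most n. Each round takes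
  time \<open>pi\<close>, and the final evolution takes at most \<open>pi\<close>, so the total is
  linear in n.\<close>

lemma las_vegas_complete:
  assumes n: "n \<ge> 5"
  shows "las_vegas_uniform_mixing (const_spectral n (1 - 1 / of_nat n) (- 1 / of_nat n)) (2 * pi * real n)"
proof -
  define H where "H = const_spectral n (1 - 1 / of_nat n) (- 1 / of_nat n)"
  define q where "q = (1 - 2 / real n)\<^sup>2"
  define \<tau> where "\<tau> = hit_time n"
  have \<tau>: "0 \<le> \<tau>" "\<tau> \<le> pi"
    using arccos_bounded[of "(real n - 2) / (2 * (real n - 1))"] n
    by (auto simp: \<tau>_def hit_time_def field_simps)
  have q: "0 \<le> q" "q < 1"
    using n by (simp_all add: q_def abs_square_less_1 abs_less_iff)
  have cost: "pi + \<tau> + pi * q / (1 - q) \<le> 2 * pi * real n"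
  proof -
    have "1 - q = 4 * (real n - 1) / (real n)\<^sup>2"
      using n by (simp add: q_def power2_eq_square field_simps)
    then have "1 / (1 - q) = real n * (real n / (4 * (real n - 1)))"
      by (simp add: power2_eq_square)
    also have "\<dots> \<le> real n * 1"
      using n by (intro mult_left_mono) (simp_all add: field_simps)
    finally have "pi * (1 / (1 - q)) \<le> pi * real n"
      by (intro mult_left_mono) auto
    moreover have "pi + pi * q / (1 - q) = pi * (1 / (1 - q))"
      using q by (simp add: field_simps)
    moreover have "\<tau> \<le> pi * real n"
      using \<tau>(2) n mult_left_mono[of 1 "real n" pi] pi_ge_zero by linarith
    ultimately show ?thesis by simp
  qed
  have "\<exists>p. valid_protocol n p \<and> (let law = run_protocol H p (unit_vec n u) 0 in
      lossless_spmf law \<and> (\<forall>(\<psi>, s)\<in>set_spmf law. uniform_state \<psi>) \<and>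
      (\<integral>\<^sup>+ (\<psi>, s). ennreal s \<partial>measure_spmf law) \<le> ennreal (2 * pi * real n))" if u: "u < n" for u
  proof -
    define p where "p = mixing_protocol u \<tau> False"
    define X :: "(complex \<times> real) set" where "X = {(c, s). cmod c = 1 \<and> 0 \<le> s}"
    define L where "L = (\<lambda>(c, s). run_protocol H p (c \<cdot>\<^sub>v unit_vec n u) s)"
    define out where "out = (\<lambda>(c, s). (evolve H \<tau>
        (vec n (\<lambda>i. if i = u then 0 else - (c * cis (pi / n)) / of_real (sqrt (real n - 1)))), s + pi + \<tau>))"
    interpret geometric_loop L q X "\<lambda>(c, s). (c * cis (pi / n), s + pi)" out
    proof
      fix x assume "x \<in> X"
      then show "L x = bind_pmf (bernoulli_pmf q) (\<lambda>j. if j then L (case x of (c, s) \<Rightarrow> (c * cis (pi / n), s + pi))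
          else return_spmf (out x))"
        using run_mixing_protocol[OF n u _ H_def, of "fst x" \<tau> "snd x"]
        by (cases x) (simp only: L_def X_def out_def p_def q_def case_prod_conv mem_Collect_eq fst_conv snd_conv)
    qed (use q in \<open>auto simp: X_def norm_mult\<close>)
    have x: "(1, 0) \<in> X" by (simp add: X_def)
    have L1: "L (1, 0) = run_protocol H p (unit_vec n u) 0"
      by (simp add: L_def)
    have "uniform_state (fst (out x))" if "x \<in> X" for x
      using uniform_evolve_rest[OF n u, of "fst x * cis (pi / n)"] that
      by (cases x) (simp only: X_def out_def H_def \<tau>_def norm_mult norm_cis mult_1_right
          case_prod_conv mem_Collect_eq fst_conv)
    then have "\<forall>y\<in>set_spmf (L (1, 0)). uniform_state (fst y)"
      using set_spmf_subset[OF x] by auto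
    moreover have "(\<integral>\<^sup>+ y. ennreal (snd y) \<partial>measure_spmf (L (1, 0))) \<le> ennreal (2 * pi * real n)"
    proof -
      have "(\<integral>\<^sup>+ y. ennreal (snd y) \<partial>measure_spmf (L (1, 0))) \<le>
          ennreal (snd (1 :: complex, 0 :: real) + (pi + \<tau>) + pi * q / (1 - q))"
        \<comment> \<open>The accumulated cost \<open>h\<close> is the elapsed time
          \<open>snd\<close>, with \<open>d = pi\<close> and \<open>e = pi + \<tau>\<close>.\<close>
        using \<tau> by (intro nn_integral_le[OF x]) (auto simp: X_def out_def add.assoc)
      also have "\<dots> \<le> ennreal (2 * pi * real n)"
        using cost by (intro ennreal_leI) simp
      finally show ?thesis .
    qed
    ultimately show ?thesis
      using lossless[OF x] valid_mixing_protocol[OF u \<tau>(1), of False] unfolding L1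
      by (intro exI[of _ p]) (auto simp: p_def Let_def case_prod_unfold)
  qed
  then show ?thesis
    by (simp add: las_vegas_uniform_mixing_def H_def)
qed

lemma las_vegas_uniform_mixing_mono:
  assumes "las_vegas_uniform_mixing H S" "S \<le> T"
  shows "las_vegas_uniform_mixing H T"
  using assms unfolding las_vegas_uniform_mixing_def Let_def
  by (meson ennreal_leI order_trans)

theorem corollary1:
  shows "\<exists>C::real>0. \<forall>n::nat\<ge>5. \<exists>\<sigma>. unitary_signing n (complete_edges n) \<sigma> \<and>
    las_vegas_uniform_mixing
      (complex_of_real (1 / real n) \<cdot>\<^sub>m signed_adjacency n (complete_edges n) \<sigma>)
      (C * real n powr (3 / 2))"
proof (intro exI[of _ "2 * pi"] conjI allI impI)
  fix n :: nat assume n: "n \<ge> 5"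
  \<comment> \<open>The linear bound is weakened to the exponent 3/2.\<close>
  have "real n powr 1 \<le> real n powr (3 / 2)"
    using n by (intro powr_mono) auto
  then have "2 * pi * real n \<le> 2 * pi * real n powr (3 / 2)"
    using n by simp
  then show "\<exists>\<sigma>. unitary_signing n (complete_edges n) \<sigma> \<and>
    las_vegas_uniform_mixing
      (complex_of_real (1 / real n) \<cdot>\<^sub>m signed_adjacency n (complete_edges n) \<sigma>)
      (2 * pi * real n powr (3 / 2))"
    using las_vegas_uniform_mixing_mono[OF las_vegas_complete[OF n]] n unitary_signing_one complete_hamiltonian_eq
    by (intro exI[of _ "\<lambda>_ _. 1"]) simp
qed simp

end
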